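(* Let $d\in\mathbb{N}$, $d\ge2$, $\beta\ge1$, $\ell$ the largest integer strictly smaller than $\beta$, $L_0,\dots,L_\ell,L_\beta>0$, and $p\in[1,\infty)$. Then there is a constant $C>0$ large enough, depending only on $d,\beta,L_0,\dots,L_\ell,L_\beta,p$, with the following property. Let $x_0\in[0,1]^d$, $\delta>0$ with $\delta\le C^{-1}$, and $T_{\mathsf{sum}}>0$ with $C\,T_{\mathsf{sum}}^{-1}\le\delta^{d-1}$. Then there are $\theta_0,\theta_1\in\Theta^{\mathsf{snake}}_{d,\beta}$ of the form $\theta_k=(f_k,(x_j)_{j=1}^m,(T_j)_{j=1}^m)$, $k\in\{0,1\}$ (with the same $m$, $(x_j)$, $(T_j)$), such that $$U(f_0,x_j,t)=U(f_1,x_j,t)\qquad\text{for all }t\in\mathbb{R},\ j\in\{1,\dots,m\},$$ and $$C\,\|f_0(x_0)-f_1(x_0)\|_2\ge\delta^\beta\qquad\text{and}\qquad C\,\big\|\,\|f_0-f_1\|_2\,\big\|_{L^p([0,1]^d)}\ge\delta^\beta.$$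
   Context: Smoothness class: $\mathcal{F}_{d,\beta}$ is the set of functions $f=(f_1,\dots,f_d):\mathbb{R}^d\to\mathbb{R}^d$ such that each component $f_j$ is $\ell$ times differentiable, $\sup_x\|D^kf_j(x)\|_{\mathsf{op}}\le L_k$ for $k=0,\dots,\ell$, and $\|D^\ell f_j(x)-D^\ell f_j(\tilde x)\|_{\mathsf{op}}\le L_\beta\|x-\tilde x\|_2^{\beta-\ell}$ for all $x,\tilde x\in\mathbb{R}^d$. Here $D^k f_j(x)$ is the $k$-th derivative as a symmetric $k$-linear form and $\|A\|_{\mathsf{op}}=\sup\{|A(v_1,\dots,v_k)|:\|v_i\|_2=1\}$; $\|\cdot\|_2$ is the Euclidean norm. Flow: for Lipschitz $f:\mathbb{R}^d\to\mathbb{R}^d$ and $x\in\mathbb{R}^d$, $t\mapsto U(f,x,t)$, $t\in\mathbb{R}$, is the solution of $\dot u(t)=f(u(t))$, $u(0)=x$. Tube: for continuously differentiable $u:[0,T]\to\mathbb{R}^d$ and $\delta>0$, $$\mathcal{T}(u,\delta)=\bigcup_{t\in[0,T]}\{u(t)+v:\ \dot u(t)\ne0,\ v^\top\dot u(t)=0,\ \|v\|_2\le\delta\}.$$ Tube distance: for $\theta=(f,(x_j)_{j=1}^m,(T_j)_{j=1}^m)$ with $f$ Lipschitz, $x_j\in\mathbb{R}^d$, $T_j>0$, let $u_j=U(f,x_j,\cdot):[0,T_j]\to\mathbb{R}^d$; for $A\subseteq\mathbb{R}^d$, $d_{\mathcal{T}}(A,\theta)=\inf\{\delta>0:\ A\subseteq\bigcup_{j=1}^m\mathcal{T}(u_j,\delta)\}$.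 Snake parameter class: $\Theta^{\mathsf{snake}}_{d,\beta}$ (depending on $L_0,\dots,L_\ell,L_\beta,\delta,T_{\mathsf{sum}}$) is the set of all $\theta=(f,(x_j)_{j=1}^m,(T_j)_{j=1}^m)\in\mathcal{F}_{d,\beta}\times(\mathbb{R}^d)^m\times(0,\infty)^m$ with $m\in\mathbb{N}$, $\sum_{j=1}^mT_j=T_{\mathsf{sum}}$, and $d_{\mathcal{T}}([0,1]^d,\theta)\le\delta$. *)

theory Defs
  imports "HOL-Analysis.Analysis"
begin

text \<open>
  \<open>form_deriv g [v\<^sub>1, \<dots>, v\<^sub>k] x\<close> is \<open>D\<^sup>k g(x)(v\<^sub>1, \<dots>, v\<^sub>k)\<close>, the \<open>k\<close>-th derivative of \<open>g\<close> at \<open>x\<close>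
  as a \<open>k\<close>-linear form; it is meaningful whenever \<open>g\<close> is \<open>k\<close> times differentiable.
\<close>
primrec form_deriv :: "('a::real_normed_vector \<Rightarrow> real) \<Rightarrow> 'a list \<Rightarrow> 'a \<Rightarrow> real" where
  "form_deriv g [] x = g x"
| "form_deriv g (v # vs) x = frechet_derivative (form_deriv g vs) (at x) v"

text \<open>
  Since the space of \<open>k\<close>-linear forms on a Euclidean space is finite-dimensional, the form-valued
  map \<open>x \<mapsto> D\<^sup>k g(x)\<close> is (Frechet) differentiable iff all its evaluations
  \<open>x \<mapsto> D\<^sup>k g(x)(v\<^sub>1, \<dots>, v\<^sub>k)\<close> are.
\<close>
definition times_differentiable :: "nat \<Rightarrow> ('a::euclidean_space \<Rightarrow> real) \<Rightarrow> bool" where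
  "times_differentiable n g \<longleftrightarrow>
     (\<forall>vs x. length vs < n \<longrightarrow> form_deriv g vs differentiable (at x))"

text \<open>Extended-real valued, so that the supremum is meaningful without a boundedness proof.\<close>
definition form_norm :: "nat \<Rightarrow> ('a::real_normed_vector list \<Rightarrow> real) \<Rightarrow> ereal" where
  "form_norm k A = (SUP vs\<in>{vs. length vs = k \<and> (\<forall>v\<in>set vs. norm v = 1)}. ereal \<bar>A vs\<bar>)"

text \<open>
  The smoothness class; \<open>l\<close> is meant to be the largest integer strictly smaller than \<open>\<beta>\<close>, and only
  \<open>L 0, \<dots>, L l\<close> are used.
\<close>
definition smooth_class ::
    "real \<Rightarrow> nat \<Rightarrow> (nat \<Rightarrow> real) \<Rightarrow> real \<Rightarrow> (real^'d \<Rightarrow> real^'d) set" where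
  "smooth_class \<beta> l L L\<^sub>\<beta> = {f. \<forall>j. let g = (\<lambda>x. f x $ j) in
     times_differentiable l g \<and>
     (\<forall>k\<le>l. (SUP x. form_norm k (\<lambda>vs. form_deriv g vs x)) \<le> ereal (L k)) \<and>
     (\<forall>x y. form_norm l (\<lambda>vs. form_deriv g vs x - form_deriv g vs y)
              \<le> ereal (L\<^sub>\<beta> * norm (x - y) powr (\<beta> - real l)))}"

text \<open>Well-defined for Lipschitz \<open>f\<close>, where the solution exists on all of \<open>\<real>\<close> and is unique.\<close>
definition flow :: "('a::real_normed_vector \<Rightarrow> 'a) \<Rightarrow> 'a \<Rightarrow> real \<Rightarrow> 'a" where
  "flow f x = (THE u. u 0 = x \<and> (\<forall>t. (u has_vector_derivative f (u t)) (at t)))"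

text \<open>The derivative is taken within \<open>[0,T]\<close>, i.e. it is one-sided at the end points.\<close>
definition tube :: "(real \<Rightarrow> 'a::real_inner) \<Rightarrow> real \<Rightarrow> real \<Rightarrow> 'a set" where
  "tube u T \<delta> = (\<Union>t\<in>{0..T}. let u' = vector_derivative u (at t within {0..T}) in
     {u t + v | v. u' \<noteq> 0 \<and> v \<bullet> u' = 0 \<and> norm v \<le> \<delta>})"

text \<open>
  The families \<open>(x\<^sub>j)\<close> and \<open>(T\<^sub>j)\<close> are lists of a common length \<open>m\<close>, indexed from 0.
\<close>
type_synonym 'a snake_param = "('a \<Rightarrow> 'a) \<times> 'a list \<times> real list"

text \<open>The infimum is taken in the extended reals, so it is \<open>\<infinity>\<close> if no \<open>\<delta>\<close> is admissible.\<close>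
definition tube_dist :: "'a::real_inner set \<Rightarrow> 'a snake_param \<Rightarrow> ereal" where
  "tube_dist A \<theta> = (case \<theta> of (f, xs, Ts) \<Rightarrow>
     INF \<delta>\<in>{\<delta>. 0 < \<delta> \<and> A \<subseteq> (\<Union>j<length xs. tube (flow f (xs ! j)) (Ts ! j) \<delta>)}. ereal \<delta>)"

definition snake_class ::
    "real \<Rightarrow> nat \<Rightarrow> (nat \<Rightarrow> real) \<Rightarrow> real \<Rightarrow> real \<Rightarrow> real \<Rightarrow> (real^'d) snake_param set" where
  "snake_class \<beta> l L L\<^sub>\<beta> \<delta> Tsum = {(f, xs, Ts).
     f \<in> smooth_class \<beta> l L L\<^sub>\<beta> \<and> length xs = length Ts \<and> (\<forall>T\<in>set Ts. 0 < T) \<and>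
     sum_list Ts = Tsum \<and> tube_dist (cbox 0 1) (f, xs, Ts) \<le> ereal \<delta>}"

definition Lp_norm :: "real \<Rightarrow> 'a::euclidean_space set \<Rightarrow> ('a \<Rightarrow> real) \<Rightarrow> real" where
  "Lp_norm p S g = (LINT x:S|lebesgue. \<bar>g x\<bar> powr p) powr (1 / p)"

end

theory Submission
  imports Defs
begin

text \<open>
  A snake observes a vector field only along its trajectories, so two fields that agree on all of
  them are indistinguishable. The pair constructed here consists of the constant field
  \<open>f\<^sub>0 = c e\<^sub>a\<close> and of \<open>f\<^sub>1 = (c + A cos (\<omega> (x\<^sub>b - s))) e\<^sub>a\<close> with \<open>a \<noteq> b\<close>, a parallel shear flow
  whose speed oscillates across the stream. Since the \<open>b\<close>-coordinate is conserved, each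
  trajectory of either field is a straight line in direction \<open>e\<^sub>a\<close>, traversed with constant speed
  (\<open>flow_wave_shear\<close>). The two flows therefore coincide on every line on which the cosine vanishes.

  The lines start on the hyperplane \<open>x\<^sub>a = 0\<close> in a square grid of spacing \<open>1/N\<close>, where \<open>N\<close> is of
  order \<open>1/\<delta>\<close>, so that their \<open>\<delta>\<close>-tubes cover the cube (\<open>ex_line_grid\<close>,
  \<open>tube_dist_axis_lines_le\<close>). There are of the order of \<open>\<delta>\<close> to the power \<open>1 - d\<close> lines, and each of them
  needs the time \<open>1/c\<close> to cross the cube; this is the budget that the hypothesis on \<open>Tsum\<close>
  provides. With \<open>\<omega> = \<pi> N\<close> the zeros of the cosine have the spacing of the grid, and the grid is
  positioned such that its lines sit in the zeros whereas \<open>x\<^sub>0\<close> sits halfway between two of them, where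
  the cosine is \<open>1\<close>.

  Each derivative of the wave costs a factor \<open>\<omega>\<close>, and interpolation between two derivatives turns
  the Hoelder seminorm of order \<open>\<beta>\<close> into \<open>\<omega>\<close> to the power \<open>\<beta>\<close>, up to constants. Because \<open>\<omega>\<close> is of
  order \<open>1/\<delta>\<close>, the smoothness class admits an amplitude \<open>A\<close> of order \<open>\<delta>\<close> to the power \<open>\<beta>\<close>
  (\<open>wave_shear_in_smooth_class\<close>). This is the difference of the two fields at \<open>x\<^sub>0\<close>, and it is also
  the order of the \<open>L\<^sup>p\<close> norm of the difference, since a wave is of the size of its amplitude on a
  fixed proportion of the cube (\<open>Lp_norm_wave_ge\<close>).
\<close>

section \<open>Shear flows along a coordinate axis\<close>

definition wave_shear :: "'d \<Rightarrow> 'd \<Rightarrow> real \<Rightarrow> real \<Rightarrow> real \<Rightarrow> real \<Rightarrow> real^'d \<Rightarrow> real^'d" where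
  "wave_shear a b c A \<omega> s x = axis a (c + A * cos (\<omega> * (x $ b - s)))"

lemma norm_axis_real: "norm (axis k r :: real^'d::finite) = \<bar>r\<bar>"
  by (simp add: norm_eq_sqrt_inner inner_axis_axis)

text \<open>
  The \<open>b\<close>-coordinate of every solution is constant, and the field depends on nothing else, so
  the velocity is constant along solutions; the straight line is therefore the only candidate.
\<close>
lemma flow_parallel_shear:
  fixes f :: "real^'d::finite \<Rightarrow> real^'d"
  assumes dep: "\<And>x y. x $ b = y $ b \<Longrightarrow> f x = f y" and zero: "\<And>x. f x $ b = 0"
  shows "flow f x = (\<lambda>t. x + t *\<^sub>R f x)"
  unfolding flow_def
proof (rule the_equality)
  have "f (x + t *\<^sub>R f x) = f x" for t
    by (rule dep) (simp add: zero)
  moreover have "((\<lambda>t. x + t *\<^sub>R f x) has_vector_derivative f x) (at t)" for t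
    by (auto intro!: derivative_eq_intros)
  ultimately show "x + 0 *\<^sub>R f x = x \<and>
      (\<forall>t. ((\<lambda>t. x + t *\<^sub>R f x) has_vector_derivative f (x + t *\<^sub>R f x)) (at t))"
    by simp
next
  fix u :: "real \<Rightarrow> real^'d"
  assume u: "u 0 = x \<and> (\<forall>t. (u has_vector_derivative f (u t)) (at t))"
  have ub: "u t $ b = x $ b" for t
  proof -
    have "((\<lambda>t. u t $ b) has_vector_derivative f (u r) $ b) (at r)" for r
      using bounded_linear.has_vector_derivative[OF bounded_linear_vec_nth] u by blast
    then have "DERIV (\<lambda>t. u t $ b) r :> 0" for r
      by (simp add: zero has_real_derivative_iff_has_vector_derivative)
    then have "u t $ b = u 0 $ b"
      using DERIV_isconst_all[of "\<lambda>t. u t $ b" t 0] by blast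
    then show ?thesis using u by simp
  qed
  have "((\<lambda>t. u t - t *\<^sub>R f x) has_vector_derivative 0) (at t within UNIV)" for t
  proof -
    have "f (u t) = f x"
      by (rule dep) (rule ub)
    then have "(u has_vector_derivative f x) (at t)"
      using u by metis
    from has_vector_derivative_diff[OF this has_vector_derivative_scaleR[OF DERIV_ident
        has_vector_derivative_const[of "f x"]]]
    show ?thesis by simp
  qed
  from has_vector_derivative_zero_constant[OF convex_UNIV this]
  obtain k where k: "\<And>t. u t - t *\<^sub>R f x = k" by auto
  from k[of 0] u have "k = x" by simp
  then show "u = (\<lambda>t. x + t *\<^sub>R f x)"
    using k by (simp add: fun_eq_iff diff_eq_eq)
qed

lemma flow_wave_shear:
  fixes x :: "real^'d::finite"
  assumes "a \<noteq> b"
  shows "flow (wave_shear a b c A \<omega> s) x = (\<lambda>t. x + t *\<^sub>R wave_shear a b c A \<omega> s x)"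
  by (rule flow_parallel_shear[of b]) (use assms in \<open>auto simp: wave_shear_def axis_def\<close>)

section \<open>Smoothness of plane waves\<close>

text \<open>
  Writing the derivative of the cosine as a phase shift by \<open>\<pi>/2\<close> keeps the shape of the function,
  so that the rule can be iterated.
\<close>
lemma has_derivative_wave:
  "((\<lambda>x::real^'d::finite. K + M * cos (\<omega> * (x $ b - s) + \<phi>)) has_derivative
    (\<lambda>v. M * \<omega> * v $ b * cos (\<omega> * (x $ b - s) + \<phi> + pi/2))) (at x)"
proof -
  have 1: "cos (\<omega> * (x $ b - s) + \<phi> + pi/2) = - sin (\<omega> * (x $ b - s) + \<phi>)"
    by (simp add: cos_add)
  have "((\<lambda>x::real^'d. x $ b) has_derivative (\<lambda>v. v $ b)) (at x)"
    by (rule bounded_linear_imp_has_derivative) (rule bounded_linear_vec_nth)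
  then show ?thesis
    unfolding 1 by (auto intro!: derivative_eq_intros)
qed

lemma form_deriv_wave:
  fixes vs :: "(real^'d::finite) list"
  shows "form_deriv (\<lambda>x. c + A * cos (\<omega> * (x $ b - s))) vs =
    (\<lambda>x. (if vs = [] then c else 0) + A * \<omega> ^ length vs * (\<Prod>v\<leftarrow>vs. v $ b) *
       cos (\<omega> * (x $ b - s) + real (length vs) * (pi/2)))"
proof (induction vs)
  case (Cons w ws)
  show ?case
    unfolding form_deriv.simps Cons.IH
    by (subst frechet_derivative_at[symmetric, OF has_derivative_wave])
       (simp add: fun_eq_iff algebra_simps add_divide_distrib)
qed (simp add: fun_eq_iff)

lemma abs_prod_list_component_le_1:
  fixes vs :: "(real^'d::finite) list"
  assumes "\<forall>v\<in>set vs. norm v = 1"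
  shows "\<bar>\<Prod>v\<leftarrow>vs. v $ b\<bar> \<le> 1"
  using assms
proof (induction vs)
  case (Cons w ws)
  then have "\<bar>w $ b\<bar> * \<bar>\<Prod>v\<leftarrow>ws. v $ b\<bar> \<le> 1 * 1"
    by (intro mult_mono) (auto intro: order_trans[OF component_le_norm_cart])
  then show ?case by (simp add: abs_mult)
qed simp

text \<open>
  The cosine is bounded and Lipschitz, hence Hoelder continuous of every intermediate order: the
  Lipschitz bound is the better one at distances up to \<open>1\<close>, the trivial bound \<open>2\<close> beyond.
\<close>
lemma abs_cos_diff_le_powr:
  fixes x y \<gamma> :: real
  assumes "0 < \<gamma>" "\<gamma> \<le> 1"
  shows "\<bar>cos x - cos y\<bar> \<le> 2 * \<bar>x - y\<bar> powr \<gamma>"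
proof (cases "\<bar>x - y\<bar> \<le> 1")
  case True
  have "\<bar>cos x - cos y\<bar> = 2 * \<bar>sin ((x + y)/2)\<bar> * \<bar>sin ((y - x)/2)\<bar>"
    by (simp add: cos_diff_cos abs_mult)
  also have "\<dots> \<le> 2 * 1 * \<bar>(y - x)/2\<bar>"
    by (intro mult_mono abs_sin_x_le_abs_x) auto
  also have "\<dots> = \<bar>x - y\<bar>" by simp
  also have "\<dots> \<le> \<bar>x - y\<bar> powr \<gamma>"
    using powr_mono'[of \<gamma> 1 "\<bar>x - y\<bar>"] True assms by (cases "x = y") auto
  finally show ?thesis using powr_ge_zero[of "\<bar>x - y\<bar>" \<gamma>] by linarith
next
  case False
  have "\<bar>cos x - cos y\<bar> \<le> 2"
    using abs_cos_le_one[of x] abs_cos_le_one[of y] by linarith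
  moreover have "1 \<le> \<bar>x - y\<bar> powr \<gamma>"
    using False assms by (intro ge_one_powr_ge_zero) auto
  ultimately show ?thesis by linarith
qed

text \<open>
  For \<open>\<omega> \<ge> 1\<close> the number \<open>A \<omega> powr \<beta>\<close> dominates all sizes \<open>A \<omega> ^ k\<close> of the derivatives up to order
  \<open>l\<close>, so that it is the only quantity to be controlled. The other half of each \<open>L k\<close> leaves
  room for the mean speed \<open>c\<close>, which enters for \<open>k = 0\<close> only, and the factor \<open>1/2\<close> in the
  condition on \<open>L\<^sub>\<beta>\<close> absorbs the constant of \<open>abs_cos_diff_le_powr\<close>.
\<close>
lemma wave_shear_in_smooth_class:
  fixes L :: "nat \<Rightarrow> real" and a b :: "'d::finite"
  assumes l: "real l < \<beta>" "\<beta> \<le> real l + 1"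
    and c: "0 \<le> c" "c \<le> L 0 / 2" and A: "0 \<le> A" and \<omega>: "1 \<le> \<omega>"
    and L: "\<And>k. k \<le> l \<Longrightarrow> A * \<omega> powr \<beta> \<le> L k / 2" and L\<beta>: "A * \<omega> powr \<beta> \<le> L\<^sub>\<beta> / 2"
  shows "wave_shear a b c A \<omega> s \<in> smooth_class \<beta> l L L\<^sub>\<beta>"
proof -
  have pow: "A * \<omega> ^ k \<le> A * \<omega> powr \<beta>" if "k \<le> l" for k
    using that \<omega> A l by (intro mult_left_mono) (auto simp: powr_realpow[symmetric] intro!: powr_mono)
  have half0: "A * \<omega> powr \<beta> \<le> L k / 2 \<and> 0 \<le> L k" if "k \<le> l" for k
    using L[OF that] mult_nonneg_nonneg[OF A powr_ge_zero[of \<omega> \<beta>]] by linarith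
  \<comment> \<open>The zero components of the field are waves as well, with vanishing mean and amplitude.\<close>
  have component: "times_differentiable l g \<and>
     (\<forall>k\<le>l. (SUP x. form_norm k (\<lambda>vs. form_deriv g vs x)) \<le> ereal (L k)) \<and>
     (\<forall>x y. form_norm l (\<lambda>vs. form_deriv g vs x - form_deriv g vs y)
              \<le> ereal (L\<^sub>\<beta> * norm (x - y) powr (\<beta> - real l)))"
    if g: "g = (\<lambda>x::real^'d. c' + A' * cos (\<omega> * (x $ b - s)))"
      and c': "0 \<le> c'" "c' \<le> c" and A': "0 \<le> A'" "A' \<le> A" for g c' A'
  proof (intro conjI allI impI)
    show "times_differentiable l g"
      unfolding times_differentiable_def g form_deriv_wave
      using has_derivative_wave differentiableI by blast
  next
    fix k assume k: "k \<le> l"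
    have "\<bar>form_deriv g vs x\<bar> \<le> L k"
      if vs: "length vs = k" "\<forall>v\<in>set vs. norm v = 1" for vs x
    proof -
      let ?P = "\<Prod>v\<leftarrow>vs. v $ b" and ?c = "cos (\<omega> * (x $ b - s) + real (length vs) * (pi/2))"
      have "\<bar>A' * \<omega> ^ k * ?P * ?c\<bar> = A' * \<omega> ^ k * \<bar>?P\<bar> * \<bar>?c\<bar>"
        using A' \<omega> by (simp add: abs_mult)
      also have "\<dots> \<le> A * \<omega> ^ k * 1 * 1"
        using A A' \<omega> abs_prod_list_component_le_1[OF vs(2)] by (intro mult_mono) auto
      also have "\<dots> \<le> L k / 2" using pow[OF k] L[OF k] by simp
      finally have "\<bar>A' * \<omega> ^ k * ?P * ?c\<bar> \<le> L k / 2" .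
      moreover have "\<bar>if vs = [] then c' else 0\<bar> \<le> L k / 2"
        using c c' half0[OF k] vs by auto
      ultimately show ?thesis
        unfolding g form_deriv_wave using vs(1) by simp
    qed
    then show "(SUP x. form_norm k (\<lambda>vs. form_deriv g vs x)) \<le> ereal (L k)"
      unfolding form_norm_def by (intro SUP_least) auto
  next
    fix x y :: "real^'d"
    let ?n = "norm (x - y)" and ?\<gamma> = "\<beta> - real l"
    have "\<bar>form_deriv g vs x - form_deriv g vs y\<bar> \<le> L\<^sub>\<beta> * ?n powr ?\<gamma>"
      if vs: "length vs = l" "\<forall>v\<in>set vs. norm v = 1" for vs
    proof -
      let ?P = "\<Prod>v\<leftarrow>vs. v $ b"
      let ?X = "\<lambda>x::real^'d. \<omega> * (x $ b - s) + real (length vs) * (pi/2)"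
      have "form_deriv g vs x - form_deriv g vs y = A' * \<omega> ^ l * ?P * (cos (?X x) - cos (?X y))"
        unfolding g form_deriv_wave using vs(1) by (simp add: algebra_simps)
      then have "\<bar>form_deriv g vs x - form_deriv g vs y\<bar> = A' * \<omega> ^ l * \<bar>?P\<bar> * \<bar>cos (?X x) - cos (?X y)\<bar>"
        using A' \<omega> by (simp add: abs_mult)
      also have "\<dots> \<le> A * \<omega> ^ l * 1 * (2 * \<bar>?X x - ?X y\<bar> powr ?\<gamma>)"
        using A A' \<omega> l abs_prod_list_component_le_1[OF vs(2)]
        by (intro mult_mono abs_cos_diff_le_powr) auto
      also have "\<bar>?X x - ?X y\<bar> = \<omega> * \<bar>(x - y) $ b\<bar>"
        using \<omega> by (simp add: abs_mult right_diff_distrib[symmetric])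
      also have "A * \<omega> ^ l * 1 * (2 * (\<omega> * \<bar>(x - y) $ b\<bar>) powr ?\<gamma>) \<le> A * \<omega> ^ l * 1 * (2 * (\<omega> * ?n) powr ?\<gamma>)"
        using A \<omega> l component_le_norm_cart[of "x - y" b]
        by (intro mult_left_mono powr_mono2) auto
      also have "\<dots> = 2 * (A * (\<omega> powr real l * \<omega> powr ?\<gamma>)) * ?n powr ?\<gamma>"
        using \<omega> by (simp add: powr_mult powr_realpow)
      also have "\<omega> powr real l * \<omega> powr ?\<gamma> = \<omega> powr \<beta>"
        by (simp flip: powr_add)
      also have "2 * (A * \<omega> powr \<beta>) * ?n powr ?\<gamma> \<le> L\<^sub>\<beta> * ?n powr ?\<gamma>"
        using L\<beta> by (intro mult_right_mono) auto
      finally show ?thesis .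
    qed
    then show "form_norm l (\<lambda>vs. form_deriv g vs x - form_deriv g vs y) \<le> ereal (L\<^sub>\<beta> * ?n powr ?\<gamma>)"
      unfolding form_norm_def by (intro SUP_least) auto
  qed
  have "(\<lambda>x. wave_shear a b c A \<omega> s x $ j) =
      (\<lambda>x::real^'d. (if j = a then c else 0) + (if j = a then A else 0) * cos (\<omega> * (x $ b - s)))" for j
    by (auto simp: wave_shear_def axis_def fun_eq_iff)
  from component[OF this] show ?thesis
    unfolding smooth_class_def Let_def using c A by auto
qed

section \<open>Covering the cube by tubes around parallel lines\<close>

lemma mem_tube_axis_line:
  fixes x y :: "real^'d::finite"
  assumes "c > 0" "T > 0" and y: "0 \<le> y $ a" "y $ a \<le> c * T" and x: "x $ a = 0"
    and close: "norm (y - x - axis a (y $ a)) \<le> \<delta>"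
  shows "y \<in> tube (\<lambda>t. x + t *\<^sub>R axis a c) T \<delta>"
proof -
  define t where "t = y $ a / c"
  have t: "t \<in> {0..T}" using assms by (auto simp: t_def field_simps)
  have "((\<lambda>t. x + t *\<^sub>R axis a c) has_vector_derivative axis a c) (at t)"
    by (auto intro!: derivative_eq_intros)
  then have d: "vector_derivative (\<lambda>t. x + t *\<^sub>R axis a c) (at t within {0..T}) = axis a c"
    using t \<open>T > 0\<close> by (intro vector_derivative_at_within_ivl) auto
  have ta: "t *\<^sub>R axis a c = axis a (y $ a)"
    using \<open>c > 0\<close> by (auto simp: t_def vec_eq_iff axis_def)
  define v where "v = y - x - axis a (y $ a)"
  have "y = (x + t *\<^sub>R axis a c) + v \<and> axis a c \<noteq> 0 \<and> v \<bullet> axis a c = 0 \<and> norm v \<le> \<delta>"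
    using close x \<open>c > 0\<close> ta by (auto simp: v_def inner_axis axis_eq_0_iff)
  with t d show ?thesis
    unfolding tube_def Let_def by (auto intro!: bexI[of _ t])
qed

text \<open>
  The grid points are offset from \<open>s\<close> by half a cell in every direction other than \<open>a\<close>: a cosine
  of half-wavelength \<open>1/N\<close> with a crest at \<open>s\<close> vanishes there. Points of the cube differ from \<open>s\<close> by at
  most \<open>1\<close> in each coordinate, so the cells \<open>-N, \<dots>, N\<close> suffice in each of the \<open>d - 1\<close> directions.
\<close>
lemma ex_line_grid:
  fixes s :: "real^'d::finite" and a :: 'd and N :: nat
  assumes N: "N \<ge> 1" and s: "s \<in> cbox 0 1"
  obtains xs :: "(real^'d) list" where "xs \<noteq> []" "length xs \<le> (3 * N) ^ (CARD('d) - 1)"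
    "\<And>x. x \<in> set xs \<Longrightarrow> x $ a = 0"
    "\<And>x k. x \<in> set xs \<Longrightarrow> k \<noteq> a \<Longrightarrow> \<exists>z::int. x $ k = s $ k + (of_int z + 1/2) / N"
    "\<And>y. y \<in> cbox 0 1 \<Longrightarrow> \<exists>x\<in>set xs. norm (y - x - axis a (y $ a)) \<le> CARD('d) / N"
proof -
  define Z where "Z = (\<Pi>\<^sub>E k\<in>UNIV - {a}. {- int N..int N})"
  define q :: "('d \<Rightarrow> int) \<Rightarrow> real^'d"
    where "q z = (\<chi> k. if k = a then 0 else s $ k + (of_int (z k) + 1/2) / N)" for z
  have fin: "finite Z" unfolding Z_def by (intro finite_PiE) auto
  have "card Z = (2 * N + 1) ^ (CARD('d) - 1)"
    unfolding Z_def by (subst card_PiE) (auto simp: nat_add_distrib nat_mult_distrib card_Diff_subset)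
  also have "\<dots> \<le> (3 * N) ^ (CARD('d) - 1)"
    using N by (intro power_mono) auto
  finally have cardZ: "card Z \<le> (3 * N) ^ (CARD('d) - 1)" .
  obtain xs where xs: "set xs = q ` Z" "distinct xs"
    using finite_distinct_list[of "q ` Z"] fin by auto
  have len: "length xs \<le> (3 * N) ^ (CARD('d) - 1)"
    using distinct_card[OF xs(2)] card_image_le[OF fin, of q] cardZ xs(1) by simp
  have near: "\<exists>x\<in>set xs. norm (y - x - axis a (y $ a)) \<le> CARD('d) / N"
    if y: "y \<in> cbox 0 1" for y
  proof -
    \<comment> \<open>The grid point at the centre of the cell of \<open>y\<close>.\<close>
    define z where "z = (\<lambda>k\<in>UNIV - {a}. \<lfloor>N * (y $ k - s $ k)\<rfloor>)"
    have bd: "\<bar>N * (y $ k - s $ k)\<bar> \<le> N" for k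
    proof -
      have "\<bar>y $ k - s $ k\<bar> \<le> 1"
        using y[unfolded mem_box_cart, rule_format, of k] s[unfolded mem_box_cart, rule_format, of k]
        by (simp add: abs_le_iff)
      then show ?thesis using N mult_left_mono[of "\<bar>y $ k - s $ k\<bar>" 1 "real N"] by (simp add: abs_mult)
    qed
    have "z \<in> Z"
      unfolding Z_def z_def
    proof (rule restrict_PiE_iff[THEN iffD2], intro ballI)
      fix k
      show "\<lfloor>N * (y $ k - s $ k)\<rfloor> \<in> {- int N..int N}"
        using bd[of k] by (auto simp: le_floor_iff floor_le_iff)
    qed
    have "\<bar>(y - q z - axis a (y $ a)) $ k\<bar> \<le> 1 / N" for k
    proof (cases "k = a")
      case False
      have "(y - q z - axis a (y $ a)) $ k = (N * (y $ k - s $ k) - of_int \<lfloor>N * (y $ k - s $ k)\<rfloor> - 1/2) / N"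
        using False N by (simp add: q_def z_def axis_def field_simps)
      also have "\<bar>\<dots>\<bar> \<le> 1 / N"
        unfolding abs_divide using N by (intro frac_le) (simp_all, linarith)
      finally show ?thesis .
    qed (simp add: q_def)
    then have "norm (y - q z - axis a (y $ a)) \<le> (\<Sum>k\<in>(UNIV::'d set). 1 / N)"
      by (intro order_trans[OF norm_le_l1_cart] sum_mono)
    then show ?thesis using \<open>z \<in> Z\<close> xs by auto
  qed
  have "xs \<noteq> []" using near[OF s] by auto
  moreover have "x $ a = 0" if "x \<in> set xs" for x
    using that xs by (auto simp: q_def)
  moreover have "\<exists>z::int. x $ k = s $ k + (of_int z + 1/2) / N" if "x \<in> set xs" "k \<noteq> a" for x k
    using that xs by (auto simp: q_def)
  ultimately show ?thesis using that len near by blast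
qed

lemma tube_dist_axis_lines_le:
  fixes xs :: "(real^'d::finite) list"
  assumes "\<delta> > 0" "c > 0" "T > 0" "c * T \<ge> 1"
    and fl: "\<And>x. x \<in> set xs \<Longrightarrow> flow f x = (\<lambda>t. x + t *\<^sub>R axis a c)"
    and start: "\<And>x. x \<in> set xs \<Longrightarrow> x $ a = 0"
    and cover: "\<And>y. y \<in> cbox 0 1 \<Longrightarrow> \<exists>x\<in>set xs. norm (y - x - axis a (y $ a)) \<le> \<delta>"
  shows "tube_dist (cbox 0 1) (f, xs, replicate (length xs) T) \<le> ereal \<delta>"
proof -
  have "y \<in> (\<Union>j<length xs. tube (flow f (xs ! j)) (replicate (length xs) T ! j) \<delta>)"
    if y: "y \<in> cbox 0 1" for y
  proof -
    obtain j where j: "j < length xs" "norm (y - xs ! j - axis a (y $ a)) \<le> \<delta>"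
      using cover[OF y] by (metis in_set_conv_nth)
    have "0 \<le> y $ a" "y $ a \<le> c * T"
      using y[unfolded mem_box_cart, rule_format, of a] assms(4) by auto
    then have "y \<in> tube (\<lambda>t. xs ! j + t *\<^sub>R axis a c) T \<delta>"
      using assms j start by (intro mem_tube_axis_line) auto
    then show ?thesis using j fl by auto
  qed
  then show ?thesis
    unfolding tube_dist_def using assms(1) by (auto intro!: INF_lower)
qed

section \<open>The size of a wave in the mean\<close>

lemma set_lebesgue_integral_continuous_cbox:
  fixes F :: "'a::euclidean_space \<Rightarrow> real"
  assumes "continuous_on UNIV F"
  shows "(LINT x:cbox u v|lebesgue. F x) = integral (cbox u v) F"
proof -
  have "set_integrable lborel (cbox u v) F"
    unfolding set_integrable_def
    by (intro borel_integrable_compact compact_cbox continuous_on_subset[OF assms]) auto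
  then have "set_integrable lebesgue (cbox u v) F"
    unfolding set_integrable_def
    using integrable_completion[OF borel_measurable_integrable] by blast
  then show ?thesis by (rule set_lebesgue_integral_eq_integral)
qed

text \<open>
  A substitute for Fubini's theorem when averaging an oscillation over a box: it suffices to
  bound \<open>F\<close> plus a translate of \<open>F\<close> pointwise from below.
\<close>
lemma integral_add_shift_le:
  fixes F :: "'a::euclidean_space \<Rightarrow> real"
  assumes cont: "continuous_on UNIV F" and nonneg: "\<And>x. 0 \<le> F x"
    and sub: "cbox u v \<subseteq> cbox u' v'" "cbox (u + w) (v + w) \<subseteq> cbox u' v'"
  shows "integral (cbox u v) (\<lambda>x. F x + F (x + w)) \<le> 2 * integral (cbox u' v') F"
proof -
  have int: "F integrable_on cbox y z" for y z
    by (intro integrable_continuous continuous_on_subset[OF cont]) auto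
  have "continuous_on UNIV (\<lambda>x. F (x + w))"
    by (rule continuous_on_compose2[OF cont]) (auto intro!: continuous_intros)
  then have int': "(\<lambda>x. F (x + w)) integrable_on cbox u v"
    by (metis integrable_continuous continuous_on_subset subset_UNIV)
  have "integral (cbox u v) (\<lambda>x. F x + F (x + w)) =
      integral (cbox u v) F + integral (cbox u v) (\<lambda>x. F (x + w))"
    by (rule integral_add[OF int int'])
  also have "integral (cbox u v) (\<lambda>x. F (x + w)) = integral (cbox (u + w) (v + w)) F"
    using integral_shift_cbox[of "u + w" w "v + w" F] by simp
  also have "integral (cbox u v) F + integral (cbox (u + w) (v + w)) F \<le> 2 * integral (cbox u' v') F"
    using integral_subset_le[OF sub(1) int int] integral_subset_le[OF sub(2) int int] nonneg by auto
  finally show ?thesis .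
qed

lemma abs_cos_or_sin_ge_half: "1/2 \<le> \<bar>cos t\<bar> \<or> 1/2 \<le> \<bar>sin t\<bar>" for t :: real
proof (rule ccontr)
  assume "\<not> ?thesis"
  then have "\<bar>cos t\<bar>\<^sup>2 < (1/2)\<^sup>2" "\<bar>sin t\<bar>\<^sup>2 < (1/2)\<^sup>2"
    by (intro power_strict_mono; simp)+
  then show False
    using sin_cos_squared_add[of t] by (simp add: power2_eq_square)
qed

text \<open>
  Translation by a quarter of a wavelength turns the cosine into a sine, and one of the two is
  always at least \<open>1/2\<close> in absolute value. As \<open>\<omega> \<ge> \<pi>\<close>, the translation is by at most \<open>1/2\<close>, so the
  box of half the side length and its translate both lie in the unit cube.
\<close>
lemma Lp_norm_wave_ge:
  fixes b :: "'d::finite"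
  assumes p: "p \<ge> 1" and A: "A \<ge> 0" and \<omega>: "\<omega> \<ge> pi"
  shows "A / 2 ^ (CARD('d) + 2) \<le> Lp_norm p (cbox 0 (1::real^'d)) (\<lambda>x. \<bar>A * cos (\<omega> * (x $ b - s))\<bar>)"
proof -
  define F where "F x = \<bar>A * cos (\<omega> * (x $ b - s))\<bar> powr p" for x :: "real^'d"
  define w :: "real^'d" where "w = axis b (pi / (2 * \<omega>))"
  define m :: "real^'d" where "m = (\<chi> k. 1/2)"
  have \<omega>0: "\<omega> > 0" using \<omega> pi_gt_zero by linarith
  have cont: "continuous_on UNIV F"
    unfolding F_def using p by (intro continuous_on_powr' continuous_intros) auto
  have w: "0 \<le> w $ k" "w $ k \<le> 1/2" for k
    using \<omega> \<omega>0 by (auto simp: w_def axis_def field_simps)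
  have shift: "F (x + w) = \<bar>A * sin (\<omega> * (x $ b - s))\<bar> powr p" for x
  proof -
    have "\<omega> * ((x + w) $ b - s) = \<omega> * (x $ b - s) + pi/2"
      using \<omega>0 by (simp add: w_def field_simps)
    then show ?thesis unfolding F_def by (simp add: cos_add abs_mult)
  qed
  have lower: "(A/2) powr p \<le> F x + F (x + w)" for x
  proof -
    have "(A/2) powr p \<le> \<bar>A * r\<bar> powr p" if "1/2 \<le> \<bar>r\<bar>" for r
      using that A p mult_left_mono[OF that A] by (intro powr_mono2) (auto simp: abs_mult)
    then show ?thesis
      using abs_cos_or_sin_ge_half[of "\<omega> * (x $ b - s)"] unfolding shift unfolding F_def
      by (meson add_increasing add_increasing2 powr_ge_zero)
  qed
  have sub: "cbox 0 m \<subseteq> cbox 0 1" "cbox (0 + w) (m + w) \<subseteq> cbox 0 1"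
  proof -
    show "cbox 0 m \<subseteq> cbox 0 1"
    proof
      fix x assume x: "x \<in> cbox 0 m"
      have "0 \<le> x $ k \<and> x $ k \<le> 1" for k
        using x[unfolded mem_box_cart, rule_format, of k] by (auto simp: m_def)
      then show "x \<in> cbox 0 1" by (simp add: mem_box_cart)
    qed
    show "cbox (0 + w) (m + w) \<subseteq> cbox 0 1"
    proof
      fix x assume x: "x \<in> cbox (0 + w) (m + w)"
      have "0 \<le> x $ k \<and> x $ k \<le> 1" for k
        using x[unfolded mem_box_cart, rule_format, of k] w[of k] by (auto simp: m_def)
      then show "x \<in> cbox 0 1" by (simp add: mem_box_cart)
    qed
  qed
  have "cbox 0 m \<noteq> {}" by (auto simp: interval_ne_empty_cart m_def)
  then have "measure lborel (cbox 0 m) = (1/2) ^ CARD('d)"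
    by (simp add: content_cbox_cart m_def)
  then have "(1/2) ^ CARD('d) * (A/2) powr p = integral (cbox 0 m) (\<lambda>x. (A/2) powr p)"
    by simp
  also have "\<dots> \<le> integral (cbox 0 m) (\<lambda>x. F x + F (x + w))"
  proof (rule integral_le)
    have "continuous_on UNIV (\<lambda>x. F (x + w))"
      by (rule continuous_on_compose2[OF cont]) (auto intro!: continuous_intros)
    then have "continuous_on UNIV (\<lambda>x. F x + F (x + w))"
      by (intro continuous_on_add cont)
    then show "(\<lambda>x. F x + F (x + w)) integrable_on cbox 0 m"
      by (metis integrable_continuous continuous_on_subset subset_UNIV)
  qed (use lower in auto)
  also have "\<dots> \<le> 2 * integral (cbox 0 1) F"
    by (rule integral_add_shift_le[OF cont _ sub]) (simp add: F_def)
  also have "integral (cbox 0 1) F = (LINT x:cbox 0 1|lebesgue. F x)"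
    by (rule set_lebesgue_integral_continuous_cbox[OF cont, symmetric])
  finally have I: "(1/2) ^ (CARD('d) + 1) * (A/2) powr p \<le> (LINT x:cbox 0 1|lebesgue. F x)"
    by simp
  \<comment> \<open>As \<open>e \<le> 1\<close> and \<open>p \<ge> 1\<close>, the \<open>p\<close>-th root of \<open>e\<close> is at least \<open>e\<close>, which makes the bound uniform in \<open>p\<close>.\<close>
  define e :: real where "e = (1/2) ^ (CARD('d) + 1)"
  have "0 \<le> e" unfolding e_def by simp
  moreover have "e \<le> 1" unfolding e_def by (rule power_le_one) simp_all
  ultimately have e: "0 \<le> e" "e \<le> 1" by auto
  have "A/2 * e \<le> A/2 * e powr (1/p)"
    using A p e powr_mono'[of "1/p" 1 e] by (intro mult_left_mono) auto
  also have "\<dots> = (e * (A/2) powr p) powr (1/p)"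
    using A p e powr_mult[of e "(A/2) powr p" "1/p"] powr_powr[of "A/2" p "1/p"] by simp
  also have "\<dots> \<le> (LINT x:cbox 0 1|lebesgue. F x) powr (1/p)"
    using p I e unfolding e_def by (intro powr_mono2) auto
  also have "\<dots> = Lp_norm p (cbox 0 1) (\<lambda>x. \<bar>A * cos (\<omega> * (x $ b - s))\<bar>)"
    unfolding Lp_norm_def F_def by simp
  finally show ?thesis by (simp add: e_def power_divide)
qed

section \<open>The lower bound\<close>

lemma cos_grid_eq_0:
  fixes z :: int and N :: nat
  assumes "N \<ge> 1"
  shows "cos (pi * N * ((of_int z + 1/2) / N)) = 0"
proof -
  have "pi * N * ((of_int z + 1/2) / N) = of_int (2 * z + 1) * (pi/2)"
    using assms by (simp add: field_simps)
  then show ?thesis unfolding cos_zero_iff_int by (intro exI[of _ "2 * z + 1"]) simp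
qed

theorem theorem4p9:
  fixes \<beta> L\<^sub>\<beta> p :: real and L :: "nat \<Rightarrow> real" and l :: nat
  assumes "CARD('d::finite) \<ge> 2"
    and "\<beta> \<ge> 1"
    and "real l < \<beta>" and "\<And>k::int. real_of_int k < \<beta> \<Longrightarrow> k \<le> int l"
    and "\<And>k. k \<le> l \<Longrightarrow> L k > 0" and "L\<^sub>\<beta> > 0"
    and "p \<ge> 1"
  shows "\<exists>C>0. \<forall>(x\<^sub>0::real^'d) \<delta> Tsum.
    x\<^sub>0 \<in> cbox 0 1 \<longrightarrow> \<delta> > 0 \<longrightarrow> \<delta> \<le> inverse C \<longrightarrow>
    Tsum > 0 \<longrightarrow> C * inverse Tsum \<le> \<delta> ^ (CARD('d) - 1) \<longrightarrow>
    (\<exists>f\<^sub>0 f\<^sub>1 xs Ts.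
       (f\<^sub>0, xs, Ts) \<in> snake_class \<beta> l L L\<^sub>\<beta> \<delta> Tsum \<and>
       (f\<^sub>1, xs, Ts) \<in> snake_class \<beta> l L L\<^sub>\<beta> \<delta> Tsum \<and>
       (\<forall>j<length xs. \<forall>t. flow f\<^sub>0 (xs ! j) t = flow f\<^sub>1 (xs ! j) t) \<and>
       C * norm (f\<^sub>0 x\<^sub>0 - f\<^sub>1 x\<^sub>0) \<ge> \<delta> powr \<beta> \<and>
       C * Lp_norm p (cbox 0 1) (\<lambda>x. norm (f\<^sub>0 x - f\<^sub>1 x)) \<ge> \<delta> powr \<beta>)"
proof -
  let ?d = "CARD('d)"
  obtain a b :: 'd where ab: "a \<noteq> b"
    using assms(1) by (metis card_le_Suc0_iff_eq finite_class.finite_UNIV UNIV_I not_less_eq_eq numeral_2_eq_2)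
  have \<beta>l: "\<beta> \<le> real l + 1"
    using assms(4)[of "int l + 1"] by force
  \<comment> \<open>\<open>W\<close> is an upper bound for \<open>\<delta> \<omega>\<close>, and \<open>\<kappa>\<close> is the largest factor for which the amplitude
    \<open>A = \<kappa> \<delta> powr \<beta>\<close> satisfies \<open>A \<omega> powr \<beta> \<le> \<mu> / 2\<close> whenever \<open>\<delta> \<omega> \<le> W\<close>. The three terms of \<open>C\<close> below
    provide \<open>\<delta> \<le> 1\<close>, the lower bounds on the difference of the fields, and the travel time.\<close>
  define \<mu> where "\<mu> = Min (insert L\<^sub>\<beta> (L ` {..l}))"
  have \<mu>: "\<mu> > 0" "\<mu> \<le> L\<^sub>\<beta>" "\<And>k. k \<le> l \<Longrightarrow> \<mu> \<le> L k"
    unfolding \<mu>_def using assms(5,6) by (simp_all add: min.coboundedI2)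
  define c where "c = L 0 / 2"
  define W where "W = 2 * pi * ?d"
  define \<kappa> where "\<kappa> = \<mu> / (2 * W powr \<beta>)"
  have c: "c > 0" unfolding c_def using assms(5) by simp
  have W: "W > 0" unfolding W_def by simp
  have \<kappa>: "\<kappa> > 0" "\<kappa> * W powr \<beta> = \<mu> / 2" unfolding \<kappa>_def using \<mu> W by auto
  define C where "C = 1 + 2 ^ (?d + 2) / \<kappa> + (6 * real ?d) ^ (?d - 1) / c"
  have C: "C \<ge> 1" "2 ^ (?d + 2) / \<kappa> \<le> C" "(6 * real ?d) ^ (?d - 1) / c \<le> C"
    unfolding C_def using c \<kappa> by (auto simp: add_nonneg_nonneg)
  show ?thesis
  proof (intro exI[of _ C] conjI allI impI)
    show "C > 0" using C by simp
    fix x\<^sub>0 :: "real^'d" and \<delta> Tsum :: real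
    assume x0: "x\<^sub>0 \<in> cbox 0 1" and \<delta>: "\<delta> > 0" "\<delta> \<le> inverse C"
      and Tsum: "Tsum > 0" "C * inverse Tsum \<le> \<delta> ^ (?d - 1)"
    have \<delta>1: "\<delta> \<le> 1" using \<delta> C by (meson inverse_le_1_iff order_trans)
    \<comment> \<open>The grid is fine enough for tubes of radius \<open>\<delta>\<close>, and \<open>\<delta> \<le> 1\<close> makes rounding up harmless.\<close>
    define N where "N = nat \<lceil>?d / \<delta>\<rceil>"
    have "1 \<le> ?d / \<delta>" using \<delta> \<delta>1 assms(1) by (simp add: field_simps)
    then have N: "?d / \<delta> \<le> N" "real N \<le> 2 * ?d / \<delta>" "N \<ge> 1"
      unfolding N_def by (auto simp: ) linarith+
    define \<omega> where "\<omega> = pi * N"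
    define A where "A = \<kappa> * \<delta> powr \<beta>"
    define s where "s = x\<^sub>0 $ b"
    have "\<omega> \<ge> pi"
      using N(3) unfolding \<omega>_def by simp
    then have \<omega>: "\<omega> \<ge> pi" "\<omega> \<ge> 1"
      using pi_gt3 by linarith+
    have A: "A \<ge> 0" unfolding A_def using \<kappa> by simp
    have "A * \<omega> powr \<beta> = \<kappa> * (\<delta> * \<omega>) powr \<beta>"
      unfolding A_def using \<delta> \<omega> by (simp add: powr_mult)
    also have "\<dots> \<le> \<kappa> * W powr \<beta>"
      using \<kappa> \<delta> \<omega> N assms(2) unfolding W_def \<omega>_def
      by (intro mult_left_mono powr_mono2) (auto simp: field_simps)
    finally have A\<omega>: "A * \<omega> powr \<beta> \<le> \<mu> / 2" using \<kappa> by simp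
    obtain xs where xs: "xs \<noteq> []" "length xs \<le> (3 * N) ^ (?d - 1)"
      "\<And>x. x \<in> set xs \<Longrightarrow> x $ a = 0"
      "\<And>x k. x \<in> set xs \<Longrightarrow> k \<noteq> a \<Longrightarrow> \<exists>z::int. x $ k = x\<^sub>0 $ k + (of_int z + 1/2) / N"
      "\<And>y. y \<in> cbox 0 1 \<Longrightarrow> \<exists>x\<in>set xs. norm (y - x - axis a (y $ a)) \<le> ?d / N"
      using ex_line_grid[OF N(3) x0, of a] by metis
    \<comment> \<open>All of the available time is shared evenly; the lines may run on beyond the cube.\<close>
    define T where "T = Tsum / length xs"
    have T: "T > 0" unfolding T_def using Tsum xs(1) by simp
    have "real (length xs) \<le> (3 * real N) ^ (?d - 1)"
      using of_nat_mono[OF xs(2), where ?'a = real] by simp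
    also have "\<dots> \<le> (6 * real ?d / \<delta>) ^ (?d - 1)"
      using N(2) by (intro power_mono) auto
    also have "\<dots> \<le> c * C / \<delta> ^ (?d - 1)"
      using C(3) c \<delta> by (auto simp: power_divide field_simps intro!: divide_right_mono)
    also have "\<dots> \<le> c * Tsum"
      using Tsum c \<delta> by (simp add: field_simps)
    finally have cT: "c * T \<ge> 1"
      unfolding T_def using xs(1) by (simp add: field_simps)
    have fl: "flow (wave_shear a b c A' \<omega> s) x = (\<lambda>t. x + t *\<^sub>R axis a c)" if x: "x \<in> set xs" for A' x
    proof -
      obtain z :: int where "x $ b = x\<^sub>0 $ b + (of_int z + 1/2) / N"
        using xs(4)[OF x, of b] ab by metis
      then have "x $ b - s = (of_int z + 1/2) / N"
        unfolding s_def by linarith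
      then have "cos (\<omega> * (x $ b - s)) = 0"
        unfolding \<omega>_def using cos_grid_eq_0[OF N(3), of z] by simp
      then show ?thesis
        unfolding flow_wave_shear[OF ab] by (simp add: wave_shear_def)
    qed
    have "?d / N \<le> \<delta>" using N \<delta> by (simp add: field_simps)
    then have cover: "\<exists>x\<in>set xs. norm (y - x - axis a (y $ a)) \<le> \<delta>" if "y \<in> cbox 0 1" for y
      using xs(5)[OF that] order_trans by blast
    \<comment> \<open>Amplitude \<open>0\<close> gives \<open>f\<^sub>0\<close>, amplitude \<open>A\<close> gives \<open>f\<^sub>1\<close>.\<close>
    have snake: "(wave_shear a b c A' \<omega> s, xs, replicate (length xs) T) \<in> snake_class \<beta> l L L\<^sub>\<beta> \<delta> Tsum"
      if A': "0 \<le> A'" "A' \<le> A" for A'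
    proof -
      have "A' * \<omega> powr \<beta> \<le> \<mu> / 2"
        using A\<omega> mult_right_mono[OF A'(2), of "\<omega> powr \<beta>"] by simp
      then have "A' * \<omega> powr \<beta> \<le> L\<^sub>\<beta> / 2" "\<And>k. k \<le> l \<Longrightarrow> A' * \<omega> powr \<beta> \<le> L k / 2"
        using \<mu>(2,3) by force+
      then have "wave_shear a b c A' \<omega> s \<in> smooth_class \<beta> l L L\<^sub>\<beta>"
        using assms(3) \<beta>l c \<omega> A' by (intro wave_shear_in_smooth_class) (auto simp: c_def)
      moreover have "tube_dist (cbox 0 1) (wave_shear a b c A' \<omega> s, xs, replicate (length xs) T) \<le> ereal \<delta>"
        using \<delta>(1) c T cT fl xs(3) cover by (intro tube_dist_axis_lines_le)
      ultimately show ?thesis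
        unfolding snake_class_def using T xs(1) by (auto simp: sum_list_replicate T_def)
    qed
    have diff: "norm (wave_shear a b c 0 \<omega> s x - wave_shear a b c A \<omega> s x) = \<bar>A * cos (\<omega> * (x $ b - s))\<bar>" for x
    proof -
      have "wave_shear a b c 0 \<omega> s x - wave_shear a b c A \<omega> s x = axis a (- (A * cos (\<omega> * (x $ b - s))))"
        by (auto simp: wave_shear_def vec_eq_iff axis_def)
      then show ?thesis by (simp only: norm_axis_real abs_minus)
    qed
    have "\<delta> powr \<beta> = 2 ^ (?d + 2) / \<kappa> * (A / 2 ^ (?d + 2))"
      unfolding A_def using \<kappa> by simp
    also have "\<dots> \<le> C * (A / 2 ^ (?d + 2))"
      using C A by (intro mult_right_mono) auto
    finally have CA: "\<delta> powr \<beta> \<le> C * (A / 2 ^ (?d + 2))" .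
    have "\<delta> powr \<beta> \<le> C * norm (wave_shear a b c 0 \<omega> s x\<^sub>0 - wave_shear a b c A \<omega> s x\<^sub>0)"
    proof -
      have "A / 2 ^ (?d + 2) \<le> A / 1"
        using A by (intro divide_left_mono one_le_power) auto
      then have "C * (A / 2 ^ (?d + 2)) \<le> C * A"
        using C by (intro mult_left_mono) auto
      with CA show ?thesis unfolding diff using A by (simp add: s_def)
    qed
    moreover have "\<delta> powr \<beta> \<le> C * Lp_norm p (cbox 0 1) (\<lambda>x. norm (wave_shear a b c 0 \<omega> s x - wave_shear a b c A \<omega> s x))"
    proof -
      have "C * (A / 2 ^ (?d + 2)) \<le> C * Lp_norm p (cbox 0 1) (\<lambda>x::real^'d. \<bar>A * cos (\<omega> * (x $ b - s))\<bar>)"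
        using C by (intro mult_left_mono Lp_norm_wave_ge assms(7) A \<omega>(1)) auto
      with CA show ?thesis unfolding diff by linarith
    qed
    moreover have "\<forall>j<length xs. \<forall>t. flow (wave_shear a b c 0 \<omega> s) (xs ! j) t = flow (wave_shear a b c A \<omega> s) (xs ! j) t"
      using fl by simp
    ultimately show "\<exists>f\<^sub>0 f\<^sub>1 xs Ts.
       (f\<^sub>0, xs, Ts) \<in> snake_class \<beta> l L L\<^sub>\<beta> \<delta> Tsum \<and>
       (f\<^sub>1, xs, Ts) \<in> snake_class \<beta> l L L\<^sub>\<beta> \<delta> Tsum \<and>
       (\<forall>j<length xs. \<forall>t. flow f\<^sub>0 (xs ! j) t = flow f\<^sub>1 (xs ! j) t) \<and>
       C * norm (f\<^sub>0 x\<^sub>0 - f\<^sub>1 x\<^sub>0) \<ge> \<delta> powr \<beta> \<and>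
       C * Lp_norm p (cbox 0 1) (\<lambda>x. norm (f\<^sub>0 x - f\<^sub>1 x)) \<ge> \<delta> powr \<beta>"
      using snake[of 0] snake[of A] A by blast
  qed
qed

end
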